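(* Let $S\subset\mathbb{R}^n$ be nonempty and closed, let $I=\{1,\ldots,m\}$, $J=\{1,\ldots,p\}$, let $f_i^L,f_i^U,g_i^L,g_i^U\colon\mathbb{R}^n\to\mathbb{R}$ ($i\in I$) and $h_j\colon\mathbb{R}^n\to\mathbb{R}$ ($j\in J$) be locally Lipschitzian functions with $0\le f_i^L(x)\le f_i^U(x)$ and $0<g_i^L(x)\le g_i^U(x)$ for all $x\in S$, $i\in I$, and let $\Omega=\{x\in S: h_j(x)\le 0,\ j\in J\}$. Let $\bar x\in\Omega$ satisfy the KKT condition. (i) If $(F,h)$ is generalized convex on $S$ at $\bar x$, then $\bar x$ is a type-2 weakly Pareto solution of the fractional interval-valued multiobjective problem (FIMP). (ii) If $(F,h)$ is strictly generalized convex on $S$ at $\bar x$, then $\bar x$ is a type-1 Pareto solution of (FIMP), and so $\bar x$ is also a type-2 Pareto solution and a type-1 weakly Pareto solution of (FIMP).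
   Context: Variational analysis. For $S\subset\mathbb{R}^n$, $x\in S$ and $\varepsilon\ge 0$, $\widehat N_\varepsilon(x;S):=\{z^*\in\mathbb{R}^n:\limsup_{u\to x,\,u\in S}\frac{\langle z^*,u-x\rangle}{\|u-x\|}\le\varepsilon\}$. The limiting (Mordukhovich) normal cone $N(\bar x;S)$ of $S$ at $\bar x\in\mathrm{cl}\,S$ is the set of all $z^*\in\mathbb{R}^n$ for which there exist $x^k\to\bar x$ with $x^k\in S$, $\varepsilon_k\to0^+$ and $z_k^*\to z^*$ with $z_k^*\in\widehat N_{\varepsilon_k}(x^k;S)$ for all $k$. For $\varphi\colon\mathbb{R}^n\to\overline{\mathbb{R}}$ finite at $\bar x$, the limiting (Mordukhovich) subdifferential is $\partial\varphi(\bar x):=\{x^*\in\mathbb{R}^n:(x^*,-1)\in N((\bar x,\varphi(\bar x));\mathrm{epi}\,\varphi)\}$, where $\mathrm{epi}\,\varphi=\{(x,\alpha)\in\mathbb{R}^n\times\mathbb{R}:\varphi(x)\le\alpha\}$. The upper subdifferential is $\partial^+\varphi(\bar x):=-\partial(-\varphi)(\bar x)$. The polar cone of a set $C\subset\mathbb{R}^n$ is $C^\circ:=\{x^*\in\mathbb{R}^n:\langle x^*,x\rangle\le0\ \forall x\in C\}$. Sums and scalar multiples of sets are taken elementwise (Minkowski). Problem. $f_i=[f_i^L,f_i^U]$ and $g_i=[g_i^L,g_i^U]$ are interval-valued functions, and for $i\in I$ and $x\in S$ $$F_i(x):=\frac{f_i(x)}{g_i(x)}=\left[\frac{f_i^L(x)}{g_i^U(x)},\frac{f_i^U(x)}{g_i^L(x)}\right].$$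 (FIMP) is the problem of minimizing $F=(F_1,\ldots,F_m)$ over $\Omega$ with respect to the lower-upper (LU) interval order. For closed bounded intervals $A=[a^L,a^U]$, $B=[b^L,b^U]$: $A\le_{LU}B$ if $a^L\le b^L$ and $a^U\le b^U$; $A<_{LU}B$ if $A\le_{LU}B$ and $A\ne B$; $A<^s_{LU}B$ if $a^L<b^L$ and $a^U<b^U$. Solutions. A point $\bar x\in\Omega$ is, for (FIMP), a - type-1 Pareto solution if there is no $x\in\Omega$ with $F_i(x)\le_{LU}F_i(\bar x)$ for all $i\in I$ and $F_k(x)<_{LU}F_k(\bar x)$ for at least one $k\in I$; - type-2 Pareto solution if there is no $x\in\Omega$ with $F_i(x)\le_{LU}F_i(\bar x)$ for all $i\in I$ and $F_k(x)<^s_{LU}F_k(\bar x)$ for at least one $k\in I$; - type-1 weakly Pareto solution if there is no $x\in\Omega$ with $F_i(x)<_{LU}F_i(\bar x)$ for all $i\in I$; - type-2 weakly Pareto solution if there is no $x\in\Omega$ with $F_i(x)<^s_{LU}F_i(\bar x)$ for all $i\in I$. KKT condition: $\bar x\in\Omega$ satisfies the KKT condition if there exist $\lambda_i^L\ge0$, $\lambda_i^U\ge0$, $i\in I$, and $\mu_j\ge0$, $j\in J$, with $\sum_{i\in I}(\lambda_i^L+\lambda_i^U)+\sum_{j\in J}\mu_j=1$ and $(\lambda^L,\lambda^U)\ne(0,0)$, where $\lambda^L=(\lambda^L_1,\ldots,\lambda^L_m)$, $\lambda^U=(\lambda^U_1,\ldots,\lambda^U_m)$, such that $$0\in \sum_{i\in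 I}\frac{\lambda_i^L}{g_i^U(\bar x)} \left[\partial f_i^L(\bar x)-\frac{f_i^L(\bar x)}{g_i^U(\bar x)}\partial^+ g_i^U(\bar x)\right]+\sum_{i\in I}\frac{\lambda_i^U}{g_i^L(\bar x)} \left[\partial f_i^U(\bar x)-\frac{f_i^U(\bar x)}{g_i^L(\bar x)}\partial^+ g_i^L(\bar x)\right]+\sum_{j\in J}\mu_j\partial h_j(\bar x)+N(\bar x; S)$$ and $\mu_jh_j(\bar x)=0$ for all $j\in J$. Generalized convexity. $(F,h)$ is generalized convex on $S$ at $\bar x\in S$ if for any $x\in S$, $x_i^{*L}\in\partial f_i^L(\bar x)$, $x_i^{*U}\in\partial f_i^U(\bar x)$, $y_i^{*L}\in\partial^+g_i^L(\bar x)$, $y_i^{*U}\in\partial^+g_i^U(\bar x)$, $i\in I$, and $z_j^*\in\partial h_j(\bar x)$, $j\in J$, there exists $\nu\in[N(\bar x;S)]^\circ$ such that for all $i\in I$, $j\in J$: $f_i^L(x)-f_i^L(\bar x)\ge\langle x_i^{*L},\nu\rangle$, $f_i^U(x)-f_i^U(\bar x)\ge\langle x_i^{*U},\nu\rangle$, $g_i^L(x)-g_i^L(\bar x)\le\langle y_i^{*L},\nu\rangle$, $g_i^U(x)-g_i^U(\bar x)\le\langle y_i^{*U},\nu\rangle$, $h_j(x)-h_j(\bar x)\ge\langle z_j^*,\nu\rangle$. $(F,h)$ is strictly generalized convex on $S$ at $\bar x$ if the same holds for any $x\in S\setminus\{\bar x\}$ (and any such subgradients) with the first two inequalities (those for $f_i^L$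 and $f_i^U$) strict. *)

theory Defs
  imports "HOL-Analysis.Analysis" "HOL-Library.Interval" "HOL-Library.Set_Algebras"
begin

definition locally_lipschitz :: "('a::metric_space \<Rightarrow> 'b::metric_space) \<Rightarrow> bool" where
  "locally_lipschitz f \<longleftrightarrow> (\<forall>x. \<exists>r>0. \<exists>L. L-lipschitz_on (ball x r) f)"

(* The limit superior excludes u = x.  If x is isolated in S, it is taken along the trivial
   filter and equals -\<infinity>, so every vector is an eps-normal there. *)
definition eps_normals :: "real \<Rightarrow> 'a::euclidean_space \<Rightarrow> 'a set \<Rightarrow> 'a set" where
  "eps_normals \<epsilon> x S =
     {z. Limsup (at x within S) (\<lambda>u. ereal (z \<bullet> (u - x) / norm (u - x))) \<le> ereal \<epsilon>}"

definition limiting_normal_cone :: "'a::euclidean_space \<Rightarrow> 'a set \<Rightarrow> 'a set" where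
  "limiting_normal_cone x S =
     {z. \<exists>xs \<epsilon> zs. xs \<longlonglongrightarrow> x \<and> (\<forall>k::nat. xs k \<in> S) \<and>
           \<epsilon> \<longlonglongrightarrow> 0 \<and> (\<forall>k. 0 < \<epsilon> k) \<and>
           zs \<longlonglongrightarrow> z \<and> (\<forall>k. zs k \<in> eps_normals (\<epsilon> k) (xs k) S)}"

definition epi :: "('a \<Rightarrow> ereal) \<Rightarrow> ('a \<times> real) set" where
  "epi \<phi> = {(x, \<alpha>). \<phi> x \<le> ereal \<alpha>}"

(* Meaningful only where \<phi> is finite. *)
definition limiting_subdiff :: "('a::euclidean_space \<Rightarrow> ereal) \<Rightarrow> 'a \<Rightarrow> 'a set" where
  "limiting_subdiff \<phi> x =
     {x'. (x', - 1) \<in> limiting_normal_cone (x, real_of_ereal (\<phi> x)) (epi \<phi>)}"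

definition upper_subdiff :: "('a::euclidean_space \<Rightarrow> ereal) \<Rightarrow> 'a \<Rightarrow> 'a set" where
  "upper_subdiff \<phi> x = uminus ` limiting_subdiff (\<lambda>y. - \<phi> y) x"

abbreviation subdiff_real :: "('a::euclidean_space \<Rightarrow> real) \<Rightarrow> 'a \<Rightarrow> 'a set" where
  "subdiff_real f \<equiv> limiting_subdiff (\<lambda>y. ereal (f y))"

abbreviation upper_subdiff_real :: "('a::euclidean_space \<Rightarrow> real) \<Rightarrow> 'a \<Rightarrow> 'a set" where
  "upper_subdiff_real f \<equiv> upper_subdiff (\<lambda>y. ereal (f y))"

definition polar_cone :: "'a::real_inner set \<Rightarrow> 'a set" where
  "polar_cone C = {z. \<forall>x\<in>C. z \<bullet> x \<le> 0}"

(* The library order on intervals is inclusion, hence separate relations for the LU order. *)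
definition le_LU :: "real interval \<Rightarrow> real interval \<Rightarrow> bool" where
  "le_LU A B \<longleftrightarrow> lower A \<le> lower B \<and> upper A \<le> upper B"

definition less_LU :: "real interval \<Rightarrow> real interval \<Rightarrow> bool" where
  "less_LU A B \<longleftrightarrow> le_LU A B \<and> A \<noteq> B"

definition sless_LU :: "real interval \<Rightarrow> real interval \<Rightarrow> bool" where
  "sless_LU A B \<longleftrightarrow> lower A < lower B \<and> upper A < upper B"

(* Interval (a, b) is specified only for a \<le> b.  The sign conditions of the problem guarantee
   this on S, which contains every point at which the objective is evaluated. *)
definition frac_interval ::
  "('i \<Rightarrow> 'a \<Rightarrow> real) \<Rightarrow> ('i \<Rightarrow> 'a \<Rightarrow> real) \<Rightarrow> ('i \<Rightarrow> 'a \<Rightarrow> real) \<Rightarrow> ('i \<Rightarrow> 'a \<Rightarrow> real)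
    \<Rightarrow> 'i \<Rightarrow> 'a \<Rightarrow> real interval" where
  "frac_interval fL fU gL gU i x = Interval (fL i x / gU i x, fU i x / gL i x)"

definition type1_Pareto :: "'i set \<Rightarrow> ('i \<Rightarrow> 'a \<Rightarrow> real interval) \<Rightarrow> 'a set \<Rightarrow> 'a \<Rightarrow> bool" where
  "type1_Pareto I F \<Omega> xbar \<longleftrightarrow> xbar \<in> \<Omega> \<and>
     \<not> (\<exists>x\<in>\<Omega>. (\<forall>i\<in>I. le_LU (F i x) (F i xbar)) \<and> (\<exists>k\<in>I. less_LU (F k x) (F k xbar)))"

definition type2_Pareto :: "'i set \<Rightarrow> ('i \<Rightarrow> 'a \<Rightarrow> real interval) \<Rightarrow> 'a set \<Rightarrow> 'a \<Rightarrow> bool" where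
  "type2_Pareto I F \<Omega> xbar \<longleftrightarrow> xbar \<in> \<Omega> \<and>
     \<not> (\<exists>x\<in>\<Omega>. (\<forall>i\<in>I. le_LU (F i x) (F i xbar)) \<and> (\<exists>k\<in>I. sless_LU (F k x) (F k xbar)))"

definition type1_weakly_Pareto :: "'i set \<Rightarrow> ('i \<Rightarrow> 'a \<Rightarrow> real interval) \<Rightarrow> 'a set \<Rightarrow> 'a \<Rightarrow> bool" where
  "type1_weakly_Pareto I F \<Omega> xbar \<longleftrightarrow> xbar \<in> \<Omega> \<and>
     \<not> (\<exists>x\<in>\<Omega>. \<forall>i\<in>I. less_LU (F i x) (F i xbar))"

definition type2_weakly_Pareto :: "'i set \<Rightarrow> ('i \<Rightarrow> 'a \<Rightarrow> real interval) \<Rightarrow> 'a set \<Rightarrow> 'a \<Rightarrow> bool" where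
  "type2_weakly_Pareto I F \<Omega> xbar \<longleftrightarrow> xbar \<in> \<Omega> \<and>
     \<not> (\<exists>x\<in>\<Omega>. \<forall>i\<in>I. sless_LU (F i x) (F i xbar))"

(* Sums of sets are Minkowski sums (Set_Algebras); the empty sum is {0}.  Since (-) on sets is
   the set-theoretic difference, A - c B is written as A plus the image of B under scaling by - c. *)
definition KKT ::
  "'i set \<Rightarrow> 'j set \<Rightarrow> ('i \<Rightarrow> 'a \<Rightarrow> real) \<Rightarrow> ('i \<Rightarrow> 'a \<Rightarrow> real) \<Rightarrow> ('i \<Rightarrow> 'a \<Rightarrow> real) \<Rightarrow> ('i \<Rightarrow> 'a \<Rightarrow> real)
    \<Rightarrow> ('j \<Rightarrow> 'a \<Rightarrow> real) \<Rightarrow> 'a::euclidean_space set \<Rightarrow> 'a \<Rightarrow> bool" where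
  "KKT I J fL fU gL gU h S xbar \<longleftrightarrow>
     (\<exists>lL lU \<mu>.
        (\<forall>i\<in>I. 0 \<le> lL i \<and> 0 \<le> lU i) \<and> (\<forall>j\<in>J. 0 \<le> \<mu> j) \<and>
        (\<Sum>i\<in>I. lL i + lU i) + (\<Sum>j\<in>J. \<mu> j) = 1 \<and>
        \<not> (\<forall>i\<in>I. lL i = 0 \<and> lU i = 0) \<and>
        0 \<in> (\<Sum>i\<in>I. (*\<^sub>R) (lL i / gU i xbar) `
                 (subdiff_real (fL i) xbar +
                  (*\<^sub>R) (- (fL i xbar / gU i xbar)) ` upper_subdiff_real (gU i) xbar))
            + (\<Sum>i\<in>I. (*\<^sub>R) (lU i / gL i xbar) `
                 (subdiff_real (fU i) xbar +
                  (*\<^sub>R) (- (fU i xbar / gL i xbar)) ` upper_subdiff_real (gL i) xbar))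
            + (\<Sum>j\<in>J. (*\<^sub>R) (\<mu> j) ` subdiff_real (h j) xbar)
            + limiting_normal_cone xbar S \<and>
        (\<forall>j\<in>J. \<mu> j * h j xbar = 0))"

definition generalized_convex ::
  "'i set \<Rightarrow> 'j set \<Rightarrow> ('i \<Rightarrow> 'a \<Rightarrow> real) \<Rightarrow> ('i \<Rightarrow> 'a \<Rightarrow> real) \<Rightarrow> ('i \<Rightarrow> 'a \<Rightarrow> real) \<Rightarrow> ('i \<Rightarrow> 'a \<Rightarrow> real)
    \<Rightarrow> ('j \<Rightarrow> 'a \<Rightarrow> real) \<Rightarrow> 'a::euclidean_space set \<Rightarrow> 'a \<Rightarrow> bool" where
  "generalized_convex I J fL fU gL gU h S xbar \<longleftrightarrow>
     (\<forall>x\<in>S. \<forall>xL xU yL yU z.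
        (\<forall>i\<in>I. xL i \<in> subdiff_real (fL i) xbar \<and> xU i \<in> subdiff_real (fU i) xbar \<and>
                yL i \<in> upper_subdiff_real (gL i) xbar \<and> yU i \<in> upper_subdiff_real (gU i) xbar) \<and>
        (\<forall>j\<in>J. z j \<in> subdiff_real (h j) xbar) \<longrightarrow>
        (\<exists>\<nu> \<in> polar_cone (limiting_normal_cone xbar S).
          (\<forall>i\<in>I. fL i x - fL i xbar \<ge> xL i \<bullet> \<nu> \<and> fU i x - fU i xbar \<ge> xU i \<bullet> \<nu> \<and>
                  gL i x - gL i xbar \<le> yL i \<bullet> \<nu> \<and> gU i x - gU i xbar \<le> yU i \<bullet> \<nu>) \<and>
          (\<forall>j\<in>J. h j x - h j xbar \<ge> z j \<bullet> \<nu>)))"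

definition strictly_generalized_convex ::
  "'i set \<Rightarrow> 'j set \<Rightarrow> ('i \<Rightarrow> 'a \<Rightarrow> real) \<Rightarrow> ('i \<Rightarrow> 'a \<Rightarrow> real) \<Rightarrow> ('i \<Rightarrow> 'a \<Rightarrow> real) \<Rightarrow> ('i \<Rightarrow> 'a \<Rightarrow> real)
    \<Rightarrow> ('j \<Rightarrow> 'a \<Rightarrow> real) \<Rightarrow> 'a::euclidean_space set \<Rightarrow> 'a \<Rightarrow> bool" where
  "strictly_generalized_convex I J fL fU gL gU h S xbar \<longleftrightarrow>
     (\<forall>x\<in>S - {xbar}. \<forall>xL xU yL yU z.
        (\<forall>i\<in>I. xL i \<in> subdiff_real (fL i) xbar \<and> xU i \<in> subdiff_real (fU i) xbar \<and>
                yL i \<in> upper_subdiff_real (gL i) xbar \<and> yU i \<in> upper_subdiff_real (gU i) xbar) \<and>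
        (\<forall>j\<in>J. z j \<in> subdiff_real (h j) xbar) \<longrightarrow>
        (\<exists>\<nu> \<in> polar_cone (limiting_normal_cone xbar S).
          (\<forall>i\<in>I. fL i x - fL i xbar > xL i \<bullet> \<nu> \<and> fU i x - fU i xbar > xU i \<bullet> \<nu> \<and>
                  gL i x - gL i xbar \<le> yL i \<bullet> \<nu> \<and> gU i x - gU i xbar \<le> yU i \<bullet> \<nu>) \<and>
          (\<forall>j\<in>J. h j x - h j xbar \<ge> z j \<bullet> \<nu>)))"

end

theory Submission
  imports Defs
begin

text \<open>
  Choose subgradients realizing the KKT inclusion and pair the resulting vanishing sum with a
  direction \<open>\<nu>\<close> in the polar of the normal cone. Complementary slackness and the
  nonnegativity of the multipliers then forbid that all constraint terms are nonpositive and all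
  objective terms negative. Generalized convexity turns a point that improves on \<open>xbar\<close>
  into such a \<open>\<nu>\<close>, since \<open>f(x) - f(xbar) - (f(xbar) / g(xbar)) (g(x) - g(xbar))\<close>
  equals \<open>g(x) (f(x) / g(x) - f(xbar) / g(xbar))\<close>.
\<close>

lemma mem_sum_setE:
  fixes A :: "'i \<Rightarrow> 'a::comm_monoid_add set"
  assumes "finite I" and "x \<in> (\<Sum>i\<in>I. A i)"
  obtains s where "\<forall>i\<in>I. s i \<in> A i" and "x = (\<Sum>i\<in>I. s i)"
  using assms(2) unfolding set_sum_alt[OF assms(1)] by blast

text \<open>Turns membership in one objective part of the KKT inclusion into a choice of one
  subgradient and one upper subgradient per index. The image under scaling by \<open>- r i\<close>
  becomes an ordinary vector subtraction, ready to be paired with a direction.\<close>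

lemma weighted_Minkowski_sumE:
  fixes A B :: "'i \<Rightarrow> 'a::real_vector set"
  assumes "finite I"
    and "w \<in> (\<Sum>i\<in>I. (*\<^sub>R) (c i) ` (A i + (*\<^sub>R) (- r i) ` B i))"
  obtains a b where "\<forall>i\<in>I. a i \<in> A i" and "\<forall>i\<in>I. b i \<in> B i"
    and "w = (\<Sum>i\<in>I. c i *\<^sub>R (a i - r i *\<^sub>R b i))"
proof -
  obtain s where s: "\<forall>i\<in>I. s i \<in> (*\<^sub>R) (c i) ` (A i + (*\<^sub>R) (- r i) ` B i)"
    and w: "w = (\<Sum>i\<in>I. s i)"
    by (rule mem_sum_setE[OF assms])
  have "\<forall>i\<in>I. \<exists>a b. a \<in> A i \<and> b \<in> B i \<and> s i = c i *\<^sub>R (a - r i *\<^sub>R b)"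
    using s by (fastforce elim!: set_plus_elim)
  then obtain a b where "\<forall>i\<in>I. a i \<in> A i \<and> b i \<in> B i \<and> s i = c i *\<^sub>R (a i - r i *\<^sub>R b i)"
    by metis
  with w show thesis by (intro that[of a b]) auto
qed

lemma weighted_set_sumE:
  fixes A :: "'i \<Rightarrow> 'a::real_vector set"
  assumes "finite I" and "w \<in> (\<Sum>i\<in>I. (*\<^sub>R) (c i) ` A i)"
  obtains a where "\<forall>i\<in>I. a i \<in> A i" and "w = (\<Sum>i\<in>I. c i *\<^sub>R a i)"
proof -
  obtain s where s: "\<forall>i\<in>I. s i \<in> (*\<^sub>R) (c i) ` A i" and w: "w = (\<Sum>i\<in>I. s i)"
    by (rule mem_sum_setE[OF assms])
  then have "\<forall>i\<in>I. \<exists>a. a \<in> A i \<and> s i = c i *\<^sub>R a" by blast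
  then obtain a where "\<forall>i\<in>I. a i \<in> A i \<and> s i = c i *\<^sub>R a i" by metis
  with w show thesis by (intro that[of a]) auto
qed

lemma mem_set_plus4E:
  assumes "x \<in> A + B + C + D"
  obtains a b c d where "x = a + b + c + d" and "a \<in> A" and "b \<in> B" and "c \<in> C" and "d \<in> D"
  using assms by (auto elim!: set_plus_elim)

text \<open>The subgradients are fixed before \<nu> is quantified, because generalized convexity
  supplies a \<nu> that depends on them. Only constraints active at \<open>xbar\<close> are
  restricted: complementary slackness makes the multipliers of the others vanish. Nonemptiness of
  \<open>I\<close> is recorded too, as it follows from the objective multipliers not all being
  zero.\<close>

lemma KKT_no_descent:
  fixes S :: "'a::euclidean_space set"
  assumes fin: "finite I" "finite J"
    and pos: "\<And>i. i \<in> I \<Longrightarrow> 0 < gL i xbar \<and> 0 < gU i xbar"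
    and KKT: "KKT I J fL fU gL gU h S xbar"
  obtains xL xU yL yU z
  where "\<forall>i\<in>I. xL i \<in> subdiff_real (fL i) xbar \<and> xU i \<in> subdiff_real (fU i) xbar \<and>
           yL i \<in> upper_subdiff_real (gL i) xbar \<and> yU i \<in> upper_subdiff_real (gU i) xbar"
    and "\<forall>j\<in>J. z j \<in> subdiff_real (h j) xbar"
    and "I \<noteq> {}"
    and "\<forall>\<nu>\<in>polar_cone (limiting_normal_cone xbar S).
           (\<forall>j\<in>J. h j xbar = 0 \<longrightarrow> z j \<bullet> \<nu> \<le> 0) \<longrightarrow>
           \<not> (\<forall>i\<in>I. xL i \<bullet> \<nu> < fL i xbar / gU i xbar * (yU i \<bullet> \<nu>) \<and>
                     xU i \<bullet> \<nu> < fU i xbar / gL i xbar * (yL i \<bullet> \<nu>))"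
proof -
  obtain lL lU \<mu> where
    l: "\<forall>i\<in>I. 0 \<le> lL i \<and> 0 \<le> lU i" and \<mu>: "\<forall>j\<in>J. 0 \<le> \<mu> j"
    and nz: "\<not> (\<forall>i\<in>I. lL i = 0 \<and> lU i = 0)"
    and slack: "\<forall>j\<in>J. \<mu> j * h j xbar = 0"
    and mem: "0 \<in> (\<Sum>i\<in>I. (*\<^sub>R) (lL i / gU i xbar) `
                 (subdiff_real (fL i) xbar +
                  (*\<^sub>R) (- (fL i xbar / gU i xbar)) ` upper_subdiff_real (gU i) xbar))
            + (\<Sum>i\<in>I. (*\<^sub>R) (lU i / gL i xbar) `
                 (subdiff_real (fU i) xbar +
                  (*\<^sub>R) (- (fU i xbar / gL i xbar)) ` upper_subdiff_real (gL i) xbar))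
            + (\<Sum>j\<in>J. (*\<^sub>R) (\<mu> j) ` subdiff_real (h j) xbar)
            + limiting_normal_cone xbar S"
    using KKT unfolding KKT_def by (elim exE conjE) (rule that)
  from mem obtain u v w n where sum0: "0 = u + v + w + n"
    and u: "u \<in> (\<Sum>i\<in>I. (*\<^sub>R) (lL i / gU i xbar) `
                 (subdiff_real (fL i) xbar +
                  (*\<^sub>R) (- (fL i xbar / gU i xbar)) ` upper_subdiff_real (gU i) xbar))"
    and v: "v \<in> (\<Sum>i\<in>I. (*\<^sub>R) (lU i / gL i xbar) `
                 (subdiff_real (fU i) xbar +
                  (*\<^sub>R) (- (fU i xbar / gL i xbar)) ` upper_subdiff_real (gL i) xbar))"
    and w: "w \<in> (\<Sum>j\<in>J. (*\<^sub>R) (\<mu> j) ` subdiff_real (h j) xbar)"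
    and n: "n \<in> limiting_normal_cone xbar S"
    by (rule mem_set_plus4E)
  obtain xL yU where xL: "\<forall>i\<in>I. xL i \<in> subdiff_real (fL i) xbar"
    and yU: "\<forall>i\<in>I. yU i \<in> upper_subdiff_real (gU i) xbar"
    and u_eq: "u = (\<Sum>i\<in>I. (lL i / gU i xbar) *\<^sub>R (xL i - (fL i xbar / gU i xbar) *\<^sub>R yU i))"
    by (rule weighted_Minkowski_sumE[OF fin(1) u])
  obtain xU yL where xU: "\<forall>i\<in>I. xU i \<in> subdiff_real (fU i) xbar"
    and yL: "\<forall>i\<in>I. yL i \<in> upper_subdiff_real (gL i) xbar"
    and v_eq: "v = (\<Sum>i\<in>I. (lU i / gL i xbar) *\<^sub>R (xU i - (fU i xbar / gL i xbar) *\<^sub>R yL i))"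
    by (rule weighted_Minkowski_sumE[OF fin(1) v])
  obtain z where z: "\<forall>j\<in>J. z j \<in> subdiff_real (h j) xbar"
    and w_eq: "w = (\<Sum>j\<in>J. \<mu> j *\<^sub>R z j)"
    by (rule weighted_set_sumE[OF fin(2) w])
  show thesis
  proof (rule that[of xL xU yL yU z])
    show "I \<noteq> {}" using nz by blast
  next
    show "\<forall>\<nu>\<in>polar_cone (limiting_normal_cone xbar S).
           (\<forall>j\<in>J. h j xbar = 0 \<longrightarrow> z j \<bullet> \<nu> \<le> 0) \<longrightarrow>
           \<not> (\<forall>i\<in>I. xL i \<bullet> \<nu> < fL i xbar / gU i xbar * (yU i \<bullet> \<nu>) \<and>
                     xU i \<bullet> \<nu> < fU i xbar / gL i xbar * (yL i \<bullet> \<nu>))"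
    proof (intro ballI impI notI)
      fix \<nu>
      assume \<nu>: "\<nu> \<in> polar_cone (limiting_normal_cone xbar S)"
        and zle: "\<forall>j\<in>J. h j xbar = 0 \<longrightarrow> z j \<bullet> \<nu> \<le> 0"
      assume neg: "\<forall>i\<in>I. xL i \<bullet> \<nu> < fL i xbar / gU i xbar * (yU i \<bullet> \<nu>) \<and>
                     xU i \<bullet> \<nu> < fU i xbar / gL i xbar * (yL i \<bullet> \<nu>)"
      \<comment> \<open>\<open>P i\<close> and \<open>Q i\<close> are the contributions of index
        \<open>i\<close> to the pairings of \<open>u\<close> and \<open>v\<close> with
        \<nu>.\<close>
      define P where "P i = lL i / gU i xbar * (xL i \<bullet> \<nu> - fL i xbar / gU i xbar * (yU i \<bullet> \<nu>))" for i
      define Q where "Q i = lU i / gL i xbar * (xU i \<bullet> \<nu> - fU i xbar / gL i xbar * (yL i \<bullet> \<nu>))" for i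
      have weight: "c / g * d \<le> 0" "c \<noteq> 0 \<Longrightarrow> c / g * d < 0" if "0 \<le> c" "0 < g" "d < 0" for c g d :: real
        using that by (auto simp: mult_le_0_iff mult_less_0_iff divide_le_0_iff divide_less_0_iff)
      have P: "P i \<le> 0" "lL i \<noteq> 0 \<Longrightarrow> P i < 0" and Q: "Q i \<le> 0" "lU i \<noteq> 0 \<Longrightarrow> Q i < 0"
        if "i \<in> I" for i
        unfolding P_def Q_def using that l pos neg by (intro weight; simp)+
      \<comment> \<open>A nonzero objective multiplier provides the one strictly negative summand
        that makes the whole sum negative; all other summands are merely nonpositive.\<close>
      obtain k where "k \<in> I" "lL k \<noteq> 0 \<or> lU k \<noteq> 0" using nz by blast
      then have "P k + Q k < 0" using P[of k] Q[of k] by force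
      then have "(\<Sum>i\<in>I. P i + Q i) < (\<Sum>i\<in>I. 0)"
        using fin(1) \<open>k \<in> I\<close> P(1) Q(1) by (intro sum_strict_mono_ex1) (auto intro: add_nonpos_nonpos)
      moreover have "u \<bullet> \<nu> + v \<bullet> \<nu> = (\<Sum>i\<in>I. P i + Q i)"
        unfolding u_eq v_eq P_def Q_def by (simp add: inner_sum_left inner_diff_left sum.distrib)
      \<comment> \<open>Either \<mu> vanishes at \<open>j\<close>, or slackness forces
        \<open>h j xbar = 0\<close> and \<open>zle\<close> applies.\<close>
      moreover have "\<mu> j * (z j \<bullet> \<nu>) \<le> 0" if "j \<in> J" for j
        using that \<mu> slack zle by (cases "\<mu> j = 0") (auto intro!: mult_nonneg_nonpos)
      then have "w \<bullet> \<nu> \<le> 0"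
        unfolding w_eq by (simp add: inner_sum_left sum_nonpos)
      moreover have "n \<bullet> \<nu> \<le> 0"
        using \<nu> n unfolding polar_cone_def by (auto simp: inner_commute[of n])
      moreover have "u \<bullet> \<nu> + v \<bullet> \<nu> + w \<bullet> \<nu> + n \<bullet> \<nu> = 0"
        by (simp flip: inner_add_left sum0)
      ultimately show False by simp
    qed
  qed (use xL xU yL yU z in auto)
qed

text \<open>With \<open>r = f0 / g0\<close>, the chain is
  \<open>a \<le> f - f0 \<le> r * (g - g0) \<le> r * b\<close>. The middle inequality is
  \<open>f / g \<le> r\<close> multiplied by \<open>g > 0\<close>, using \<open>f0 = r * g0\<close>;
  the last one needs \<open>r \<ge> 0\<close>, hence \<open>f0 \<ge> 0\<close>. The final
  disjunction makes the first or the middle inequality strict, so that strictness may come from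
  convexity or from the ratio.\<close>

lemma ratio_descent:
  fixes f g f0 g0 a b :: real
  assumes "0 \<le> f0" "0 < g0" "0 < g"
    and "a \<le> f - f0" and b: "g - g0 \<le> b" and "f / g \<le> f0 / g0"
    and "a < f - f0 \<or> f / g < f0 / g0"
  shows "a < f0 / g0 * b"
proof -
  define r where "r = f0 / g0"
  have r: "f0 = r * g0" "0 \<le> r" using assms unfolding r_def by auto
  have "f \<le> r * g" "f / g < f0 / g0 \<Longrightarrow> f < r * g"
    using assms unfolding r_def[symmetric] by (auto simp: field_simps)
  moreover have "r * (g - g0) \<le> r * b" by (rule mult_left_mono[OF b r(2)])
  ultimately show ?thesis
    using assms unfolding r_def[symmetric] r(1) by (auto simp: algebra_simps)
qed

lemma type1_Pareto_imp_type2_Pareto: "type1_Pareto I F \<Omega> xbar \<Longrightarrow> type2_Pareto I F \<Omega> xbar"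
  unfolding type1_Pareto_def type2_Pareto_def less_LU_def sless_LU_def by force

text \<open>A point better in every index is better in some index only if \<open>I\<close> is
  nonempty; for empty \<open>I\<close> the condition for weak dominance holds vacuously, so
  \<open>xbar\<close> would dominate itself.\<close>

lemma type1_Pareto_imp_type1_weakly_Pareto:
  "I \<noteq> {} \<Longrightarrow> type1_Pareto I F \<Omega> xbar \<Longrightarrow> type1_weakly_Pareto I F \<Omega> xbar"
  unfolding type1_Pareto_def type1_weakly_Pareto_def less_LU_def by blast

theorem theorem3p3:
  fixes S \<Omega> :: "(real ^ 'n) set" and m p :: nat and I J :: "nat set"
    and fL fU gL gU h :: "nat \<Rightarrow> real ^ 'n \<Rightarrow> real" and xbar :: "real ^ 'n"
  assumes "S \<noteq> {}" and "closed S"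
    and "I = {1..m}" and "J = {1..p}"
    and "\<And>i. i \<in> I \<Longrightarrow> locally_lipschitz (fL i)" and "\<And>i. i \<in> I \<Longrightarrow> locally_lipschitz (fU i)"
    and "\<And>i. i \<in> I \<Longrightarrow> locally_lipschitz (gL i)" and "\<And>i. i \<in> I \<Longrightarrow> locally_lipschitz (gU i)"
    and "\<And>j. j \<in> J \<Longrightarrow> locally_lipschitz (h j)"
    and "\<And>i x. i \<in> I \<Longrightarrow> x \<in> S \<Longrightarrow> 0 \<le> fL i x \<and> fL i x \<le> fU i x"
    and "\<And>i x. i \<in> I \<Longrightarrow> x \<in> S \<Longrightarrow> 0 < gL i x \<and> gL i x \<le> gU i x"
    and "\<Omega> = {x \<in> S. \<forall>j\<in>J. h j x \<le> 0}"
    and "xbar \<in> \<Omega>"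
    and "KKT I J fL fU gL gU h S xbar"
  shows "(generalized_convex I J fL fU gL gU h S xbar \<longrightarrow>
            type2_weakly_Pareto I (frac_interval fL fU gL gU) \<Omega> xbar)
       \<and> (strictly_generalized_convex I J fL fU gL gU h S xbar \<longrightarrow>
            type1_Pareto I (frac_interval fL fU gL gU) \<Omega> xbar \<and>
            type2_Pareto I (frac_interval fL fU gL gU) \<Omega> xbar \<and>
            type1_weakly_Pareto I (frac_interval fL fU gL gU) \<Omega> xbar)"
proof -
  note f_bounds = assms(10) and g_bounds = assms(11) and \<Omega>_def = assms(12)
  have xS: "xbar \<in> S" using assms(13) \<Omega>_def by simp
  have gU_pos: "0 < gU i x" if "i \<in> I" "x \<in> S" for i x using g_bounds[OF that] by simp
  have fU_nonneg: "0 \<le> fU i x" if "i \<in> I" "x \<in> S" for i x using f_bounds[OF that] by simp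
  \<comment> \<open>The endpoints can be read off only when they are in the right order. The sign
    conditions ensure this on \<open>S\<close>: the upper quotient has the larger numerator and the
    smaller positive denominator.\<close>
  have F: "lower (frac_interval fL fU gL gU i x) = fL i x / gU i x"
    "upper (frac_interval fL fU gL gU i x) = fU i x / gL i x" if "i \<in> I" "x \<in> S" for i x
  proof -
    have "fL i x / gU i x \<le> fU i x / gL i x"
      using f_bounds[OF that] g_bounds[OF that] by (intro frac_le) auto
    then show "lower (frac_interval fL fU gL gU i x) = fL i x / gU i x"
      "upper (frac_interval fL fU gL gU i x) = fU i x / gL i x"
      unfolding frac_interval_def by (simp_all add: lower.rep_eq upper.rep_eq Interval_inverse)
  qed
  have fin: "finite I" "finite J" using assms(3,4) by simp_all
  have pos: "0 < gL i xbar \<and> 0 < gU i xbar" if "i \<in> I" for i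
    using g_bounds[OF that xS] by simp
  \<comment> \<open>One choice of subgradients serves every competitor \<open>x\<close> and both
    parts of the theorem; only \<nu> will depend on \<open>x\<close>.\<close>
  obtain xL xU yL yU z where
    sub: "\<forall>i\<in>I. xL i \<in> subdiff_real (fL i) xbar \<and> xU i \<in> subdiff_real (fU i) xbar \<and>
           yL i \<in> upper_subdiff_real (gL i) xbar \<and> yU i \<in> upper_subdiff_real (gU i) xbar"
      "\<forall>j\<in>J. z j \<in> subdiff_real (h j) xbar"
    and ne: "I \<noteq> {}"
    and no_descent: "\<forall>\<nu>\<in>polar_cone (limiting_normal_cone xbar S).
           (\<forall>j\<in>J. h j xbar = 0 \<longrightarrow> z j \<bullet> \<nu> \<le> 0) \<longrightarrow>
           \<not> (\<forall>i\<in>I. xL i \<bullet> \<nu> < fL i xbar / gU i xbar * (yU i \<bullet> \<nu>) \<and>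
                     xU i \<bullet> \<nu> < fU i xbar / gL i xbar * (yL i \<bullet> \<nu>))"
    by (rule KKT_no_descent[OF fin pos assms(14)])
  \<comment> \<open>Common core of both parts. In \<open>strict\<close>, the left disjunct is what
    strict generalized convexity gives, the right one what type-2 weak dominance gives.\<close>
  have no_better: False
    if x: "x \<in> \<Omega>" and \<nu>: "\<nu> \<in> polar_cone (limiting_normal_cone xbar S)"
      and h: "\<forall>j\<in>J. h j x - h j xbar \<ge> z j \<bullet> \<nu>"
      and fg: "\<forall>i\<in>I. fL i x - fL i xbar \<ge> xL i \<bullet> \<nu> \<and> fU i x - fU i xbar \<ge> xU i \<bullet> \<nu> \<and>
                  gL i x - gL i xbar \<le> yL i \<bullet> \<nu> \<and> gU i x - gU i xbar \<le> yU i \<bullet> \<nu>"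
      and le: "\<forall>i\<in>I. le_LU (frac_interval fL fU gL gU i x) (frac_interval fL fU gL gU i xbar)"
      and strict: "\<forall>i\<in>I. (fL i x - fL i xbar > xL i \<bullet> \<nu> \<and> fU i x - fU i xbar > xU i \<bullet> \<nu>) \<or>
              sless_LU (frac_interval fL fU gL gU i x) (frac_interval fL fU gL gU i xbar)"
    for x \<nu>
  proof -
    have xS': "x \<in> S" and hx: "\<forall>j\<in>J. h j x \<le> 0" using x \<Omega>_def by auto
    have "xL i \<bullet> \<nu> < fL i xbar / gU i xbar * (yU i \<bullet> \<nu>)"
      and "xU i \<bullet> \<nu> < fU i xbar / gL i xbar * (yL i \<bullet> \<nu>)" if i: "i \<in> I" for i
    proof -
      note F = F[OF i xS] F[OF i xS']
      show "xL i \<bullet> \<nu> < fL i xbar / gU i xbar * (yU i \<bullet> \<nu>)"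
      proof (rule ratio_descent)
        show "fL i x / gU i x \<le> fL i xbar / gU i xbar" using bspec[OF le i] unfolding le_LU_def F by simp
        show "xL i \<bullet> \<nu> < fL i x - fL i xbar \<or> fL i x / gU i x < fL i xbar / gU i xbar"
          using bspec[OF strict i] unfolding sless_LU_def F by blast
      qed (use fg i f_bounds[OF i xS] gU_pos[OF i xS] gU_pos[OF i xS'] in auto)
      show "xU i \<bullet> \<nu> < fU i xbar / gL i xbar * (yL i \<bullet> \<nu>)"
      proof (rule ratio_descent)
        show "fU i x / gL i x \<le> fU i xbar / gL i xbar" using bspec[OF le i] unfolding le_LU_def F by simp
        show "xU i \<bullet> \<nu> < fU i x - fU i xbar \<or> fU i x / gL i x < fU i xbar / gL i xbar"
          using bspec[OF strict i] unfolding sless_LU_def F by blast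
      qed (use fg i fU_nonneg[OF i xS] g_bounds[OF i xS] g_bounds[OF i xS'] in auto)
    qed
    \<comment> \<open>For an active constraint, \<open>z j \<bullet> \<nu> \<le> h j x - 0\<close>,
      and feasibility of \<open>x\<close> bounds this by zero.\<close>
    moreover have "\<forall>j\<in>J. h j xbar = 0 \<longrightarrow> z j \<bullet> \<nu> \<le> 0" using h hx by force
    ultimately show False using no_descent \<nu> by blast
  qed
  have weak: "type2_weakly_Pareto I (frac_interval fL fU gL gU) \<Omega> xbar"
    if gc: "generalized_convex I J fL fU gL gU h S xbar"
    unfolding type2_weakly_Pareto_def
  proof (intro conjI notI)
    assume "\<exists>x\<in>\<Omega>. \<forall>i\<in>I. sless_LU (frac_interval fL fU gL gU i x) (frac_interval fL fU gL gU i xbar)"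
    then obtain x where x: "x \<in> \<Omega>"
      and sl: "\<forall>i\<in>I. sless_LU (frac_interval fL fU gL gU i x) (frac_interval fL fU gL gU i xbar)"
      by blast
    then have "x \<in> S" using \<Omega>_def by simp
    then obtain \<nu> where "\<nu> \<in> polar_cone (limiting_normal_cone xbar S)"
      and "\<forall>i\<in>I. fL i x - fL i xbar \<ge> xL i \<bullet> \<nu> \<and> fU i x - fU i xbar \<ge> xU i \<bullet> \<nu> \<and>
                  gL i x - gL i xbar \<le> yL i \<bullet> \<nu> \<and> gU i x - gU i xbar \<le> yU i \<bullet> \<nu>"
      and "\<forall>j\<in>J. h j x - h j xbar \<ge> z j \<bullet> \<nu>"
      using gc[unfolded generalized_convex_def, rule_format, of x xL xU yL yU z] sub by blast
    \<comment> \<open>Strict decrease of both endpoints yields \<open>le\<close> as well as the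
      right disjunct of \<open>strict\<close>.\<close>
    with x sl show False
      by (intro no_better[of x \<nu>]) (auto simp: sless_LU_def le_LU_def intro: less_imp_le)
  qed (fact assms(13))
  have strong: "type1_Pareto I (frac_interval fL fU gL gU) \<Omega> xbar"
    if sgc: "strictly_generalized_convex I J fL fU gL gU h S xbar"
    unfolding type1_Pareto_def
  proof (intro conjI notI)
    assume "\<exists>x\<in>\<Omega>. (\<forall>i\<in>I. le_LU (frac_interval fL fU gL gU i x) (frac_interval fL fU gL gU i xbar)) \<and>
      (\<exists>k\<in>I. less_LU (frac_interval fL fU gL gU k x) (frac_interval fL fU gL gU k xbar))"
    then obtain x k where x: "x \<in> \<Omega>"
      and le: "\<forall>i\<in>I. le_LU (frac_interval fL fU gL gU i x) (frac_interval fL fU gL gU i xbar)"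
      and k: "less_LU (frac_interval fL fU gL gU k x) (frac_interval fL fU gL gU k xbar)"
      by blast
    \<comment> \<open>Strict generalized convexity says nothing at \<open>xbar\<close> itself; this
      point is excluded because \<open>less_LU\<close> is irreflexive.\<close>
    have "x \<noteq> xbar" using k unfolding less_LU_def by auto
    then have "x \<in> S - {xbar}" using x \<Omega>_def by simp
    then obtain \<nu> where "\<nu> \<in> polar_cone (limiting_normal_cone xbar S)"
      and "\<forall>i\<in>I. fL i x - fL i xbar > xL i \<bullet> \<nu> \<and> fU i x - fU i xbar > xU i \<bullet> \<nu> \<and>
                  gL i x - gL i xbar \<le> yL i \<bullet> \<nu> \<and> gU i x - gU i xbar \<le> yU i \<bullet> \<nu>"
      and "\<forall>j\<in>J. h j x - h j xbar \<ge> z j \<bullet> \<nu>"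
      using sgc[unfolded strictly_generalized_convex_def, rule_format, of x xL xU yL yU z] sub by blast
    \<comment> \<open>The strict bounds on \<open>fL\<close> and \<open>fU\<close> give the left
      disjunct of \<open>strict\<close> at every index, so dominance enters only through
      \<open>le\<close>.\<close>
    with x le show False by (intro no_better[of x \<nu>]) (auto intro: less_imp_le)
  qed (fact assms(13))
  show ?thesis
    using weak strong
    by (simp add: type1_Pareto_imp_type2_Pareto type1_Pareto_imp_type1_weakly_Pareto[OF ne])
qed

end
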